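(* Let $P_{-4,k}(c)$ and $P_{-2,k}(c)$ $(k\geq -4)$ be the polynomials in $c$ satisfying the recursion $$(6+2k)P_{k}(c)=4kc\,P_{k-2}(c)-2(k-3)P_{k-4}(c)\qquad(k\geq 0)$$ with initial conditions, respectively, $P_{-4,-4}=1$, $P_{-4,-3}=P_{-4,-2}=P_{-4,-1}=0$, and $P_{-2,-2}=1$, $P_{-2,-4}=P_{-2,-3}=P_{-2,-1}=0$. Then their generating functions $P_{l}(c,z)=\sum_{k\geq 0}P_{l,k-4}(c)z^k$ $(l=-4,-2)$ are given by $$ P_{-4}(c,z)=z\sqrt{1-2cz^2+z^4}\int\frac{4cz^2-1}{z^2(z^4-2cz^2+1)^{3/2}}\,dz, $$ $$ P_{-2}(c,z)=z\sqrt{1-2cz^2+z^4}\int\frac{1}{(z^4-2cz^2+1)^{3/2}}\,dz, $$ where the integrals are formal term-by-term integrals with zero constant term.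
   Context: All identities are identities of formal series in $z$: $\sqrt{1-2cz^2+z^4}$ and $(z^4-2cz^2+1)^{-3/2}$ denote their power series expansions about $z=0$ with constant term $1$, i.e. $\sqrt{1-2cz^2+z^4}=\sum_{n\ge0}Q_n^{(-1/2)}(c)z^{2n}$ and $(1-2cz^2+z^4)^{-3/2}=\sum_{n\ge0}Q_n^{(3/2)}(c)z^{2n}$, where $Q_n^{(\lambda)}$ is the $n$-th Gegenbauer (ultraspherical) polynomial. The integral is computed by expanding the integrand as a formal Laurent series in $z$ and integrating term by term with zero constant term; e.g. the integral for $P_{-4}$ is $\sum_{n\ge0}\frac{4cQ_n^{(3/2)}(c)}{2n+1}z^{2n+1}-\sum_{n\ge0}\frac{Q_n^{(3/2)}(c)}{2n-1}z^{2n-1}$. *)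

theory Defs
  imports "HOL-Computational_Algebra.Computational_Algebra"
begin

unbundle fps_syntax

text \<open>
  Polynomials in \<open>c\<close> have type \<^typ>\<open>'a poly\<close> over an arbitrary field of characteristic zero, and
  series in \<open>z\<close> are formal power or Laurent series with such coefficients. As \<^typ>\<open>'a poly\<close> is not
  a field, the library's binomial series, division and integration of series do not apply to it
  directly.
\<close>

abbreviation (input) indet_c :: "'a::comm_ring_1 poly" where
  "indet_c \<equiv> [:0, 1:]"

text \<open>
  The power \<open>f\<^sup>\<alpha> = (1 + (f - 1))\<^sup>\<alpha>\<close> by the binomial series; meaningful only if \<open>f\<close> has constant
  term \<open>1\<close>, and then the result has constant term \<open>1\<close> too.
\<close>

definition fps_rpow :: "'a::field_char_0 poly fps \<Rightarrow> 'a \<Rightarrow> 'a poly fps" where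
  "fps_rpow f \<alpha> = fps_compose (Abs_fps (\<lambda>j. [:\<alpha> gchoose j:])) (f - 1)"

definition radicand :: "'a::field_char_0 poly fps" where
  "radicand = 1 - 2 * fps_const indet_c * fps_X ^ 2 + fps_X ^ 4"

text \<open>
  Term-by-term integration with zero constant term, as \<^const>\<open>fls_integral\<close> does over a field. It is an
  antiderivative exactly for series without a \<open>z\<^sup>-\<^sup>1\<close> term; such a term would be dropped.
  The integrands to which it is applied are even in \<open>z\<close>, hence have none.
\<close>

definition fls_poly_integral :: "'a::field_char_0 poly fls \<Rightarrow> 'a poly fls" where
  "fls_poly_integral f =
     Abs_fls (\<lambda>n. if n = 0 then 0 else smult (inverse (of_int n)) (f $$ (n - 1)))"

lemma fls_poly_integral_nth [simp]:
  "fls_poly_integral f $$ n = (if n = 0 then 0 else smult (inverse (of_int n)) (f $$ (n - 1)))"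
proof -
  define F where "F = (\<lambda>n. if n = 0 then 0 else smult (inverse (of_int n)) (f $$ (n - 1)))"
  have "\<forall>n < fls_subdegree f. F n = 0"
    by (auto simp: F_def)
  then show ?thesis
    using nth_Abs_fls_lower_bound[of "fls_subdegree f" F]
    unfolding fls_poly_integral_def F_def by simp
qed

lemma fls_deriv_poly_integral:
  assumes "f $$ (-1) = 0"
  shows "fls_deriv (fls_poly_integral f) = f"
proof (rule fls_eqI)
  fix n :: int
  show "fls_deriv (fls_poly_integral f) $$ n = f $$ n"
  proof (cases "n = -1")
    case False
    then have "(of_int (n + 1) :: 'a) \<noteq> 0"
      by (metis add.commute add_eq_0_iff of_int_eq_0_iff)
    moreover have "of_int (n + 1) * p = smult (of_int (n + 1)) p" for p :: "'a poly"
      by (simp add: of_int_poly)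
    ultimately show ?thesis
      using False by (simp del: of_int_add)
  qed (use assms in simp)
qed

lemma fps_rpow_nth_0 [simp]: "fps_rpow f \<alpha> $ 0 = 1"
  by (simp add: fps_rpow_def fps_compose_nth)

lemma fps_rpow_0 [simp]: "fps_rpow f 0 = 1"
  by (auto simp: fps_rpow_def fps_eq_iff fps_compose_nth gbinomial_0_left if_distrib if_distribR
      sum.delta cong: if_cong)

lemma fps_rpow_1:
  assumes "f $ 0 = 1"
  shows "fps_rpow f 1 = f"
proof -
  have "(1::'a) gchoose j = (if j \<le> 1 then 1 else 0)" for j
    using gbinomial_of_nat_symmetric[of j 1] binomial_gbinomial[of 1 j, where 'a = 'a]
    by (cases j) (auto simp: binomial_eq_0)
  then have "Abs_fps (\<lambda>j. [:(1::'a) gchoose j:]) = 1 + fps_X"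
    by (auto simp: fps_eq_iff)
  then show ?thesis
    using assms by (simp add: fps_rpow_def fps_compose_add_distrib)
qed

lemma fps_rpow_add:
  assumes "f $ 0 = 1"
  shows "fps_rpow f (\<alpha> + \<beta>) = fps_rpow f \<alpha> * fps_rpow f \<beta>"
proof -
  have const_sum: "[:sum g A:] = (\<Sum>i\<in>A. [:g i:])" for g :: "nat \<Rightarrow> 'a" and A
    by (induction A rule: infinite_finite_induct)
       (simp_all, metis add_pCons add_0)
  have "Abs_fps (\<lambda>j. [:(\<alpha> + \<beta>) gchoose j:]) =
        Abs_fps (\<lambda>j. [:\<alpha> gchoose j:]) * Abs_fps (\<lambda>j. [:\<beta> gchoose j:])"
    by (rule fps_ext)
       (simp add: fps_mult_nth gbinomial_Vandermonde[symmetric] const_sum atLeast0AtMost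
          mult.commute)
  then show ?thesis
    using assms by (simp add: fps_rpow_def fps_compose_mult_distrib)
qed

lemma radicand_nth_0 [simp]: "radicand $ 0 = 1"
  by (simp add: radicand_def)

lemma radicand_sqrt: "fps_rpow radicand (1/2) ^ 2 = (radicand :: 'a::field_char_0 poly fps)"
  using fps_rpow_add[OF radicand_nth_0, of "1/2" "1/2 :: 'a"]
  by (simp add: power2_eq_square fps_rpow_1)

lemma radicand_neg_three_halves:
  "fps_rpow radicand (-3/2) * fps_rpow radicand (1/2) ^ 3 = (1 :: 'a::field_char_0 poly fps)"
  using fps_rpow_add[OF radicand_nth_0, of "-3/2" "1/2 :: 'a"]
    fps_rpow_add[OF radicand_nth_0, of "-1" "1/2 :: 'a"]
    fps_rpow_add[OF radicand_nth_0, of "-1/2" "1/2 :: 'a"]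
  by (simp add: power3_eq_cube mult.assoc)

end

theory Submission
  imports Defs
begin

text \<open>
  The recursion for the coefficients of \<open>F = \<Sum>\<^sub>k P\<^sub>k\<^sub>-\<^sub>4 z\<^sup>k\<close> says that
  \<open>z R F' - (1 - 4cz\<^sup>2 + 3z\<^sup>4) F = S\<close>, where \<open>R = 1 - 2cz\<^sup>2 + z\<^sup>4\<close> and \<open>S\<close> collects the initial
  conditions. As \<open>1 - 4cz\<^sup>2 + 3z\<^sup>4 = R + z R'/2\<close>, the homogeneous equation is solved by \<open>z \<surd>R\<close>, and
  variation of constants gives the solution \<open>z \<surd>R \<integral> S z\<^sup>-\<^sup>2 R\<^sup>-\<^sup>3\<^sup>/\<^sup>2 dz\<close>. The lowest term of a
  Laurent series solving the homogeneous equation has exponent \<open>1\<close>, so a solution is determined by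
  its \<open>z\<^sup>1\<close> coefficient, which vanishes for both series.
\<close>

definition genfun_op :: "'a::field_char_0 poly fls \<Rightarrow> 'a poly fls" where
  "genfun_op F = fls_X * fps_to_fls radicand * fls_deriv F
     - (1 - 4 * fls_const indet_c * fls_X ^ 2 + 3 * fls_X ^ 4) * F"

lemma radicand_to_fls:
  "fps_to_fls radicand = 1 - 2 * fls_const indet_c * fls_X ^ 2 + fls_X ^ 4"
  by (simp add: radicand_def fls_times_fps_to_fls fps_to_fls_power)

text \<open>At \<open>n = k + 4\<close>, with \<open>F $$ n = P k\<close>, this is half the
  difference of the two sides of the recursion.\<close>

lemma genfun_op_nth:
  "genfun_op F $$ n = of_int (n - 1) * F $$ n - 2 * of_int (n - 4) * indet_c * F $$ (n - 2)
     + of_int (n - 7) * F $$ (n - 4)"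
proof -
  \<comment> \<open>The terms are grouped by the coefficient of \<open>F\<close> that they
    contribute: \<open>n\<close>, \<open>n - 2\<close> and \<open>n - 4\<close>.\<close>
  have "genfun_op F = fls_X ^ 1 * fls_deriv F - F
      - fls_const 2 * fls_const indet_c * (fls_X ^ 3 * fls_deriv F - fls_const 2 * (fls_X ^ 2 * F))
      + (fls_X ^ 5 * fls_deriv F - fls_const 3 * (fls_X ^ 4 * F))"
    unfolding genfun_op_def radicand_to_fls
    by (simp add: algebra_simps power_numeral_reduce)
  then show ?thesis
    by (simp only: fls_X_power_times_conv_shift mult.assoc) (simp add: algebra_simps)
qed

lemma genfun_op_inj:
  assumes "genfun_op F = genfun_op G" "F $$ 1 = G $$ 1"
  shows "F = G"
proof (rule ccontr)
  assume "F \<noteq> G"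
  define D where "D = F - G"
  define n where "n = fls_subdegree D"
  have D0: "D \<noteq> 0" using \<open>F \<noteq> G\<close> by (simp add: D_def)
  have "genfun_op D = 0"
    using assms(1) by (simp add: D_def genfun_op_def algebra_simps)
  then have "genfun_op D $$ n = 0" by simp
  \<comment> \<open>The coefficients at \<open>n - 2\<close> and \<open>n - 4\<close> lie below the
    subdegree, so only the indicial factor \<open>n - 1\<close> remains.\<close>
  then have "of_int (n - 1) * D $$ n = 0"
    by (simp add: genfun_op_nth n_def)
  moreover have "D $$ n \<noteq> 0" using D0 by (simp add: n_def)
  ultimately have "n = 1"
    by (metis eq_iff_diff_eq_0 mult_eq_0_iff of_int_eq_0_iff)
  with \<open>D $$ n \<noteq> 0\<close> assms(2) show False by (simp add: D_def)
qed

text \<open>\<open>radicand - 1\<close> starts with \<open>z^2\<close>. This excludes a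
  \<open>z^-1\<close> term from the integrand for \<open>P_-4\<close> and settles the
  \<open>z^1\<close> coefficient of the solutions.\<close>

lemma fps_rpow_radicand_nth_1 [simp]: "fps_rpow radicand \<alpha> $ Suc 0 = 0"
  by (simp add: fps_rpow_def fps_compose_nth radicand_def)

text \<open>Differentiating \<open>s^2 = R\<close> gives \<open>s s' = R'/2\<close>, a form free of
  division by \<open>s\<close>.\<close>

lemma sqrt_radicand_deriv:
  "fps_rpow radicand (1/2) * fps_deriv (fps_rpow radicand (1/2)) =
     2 * fps_X ^ 3 - 2 * fps_const (indet_c :: 'a::field_char_0 poly) * fps_X"
proof -
  let ?s = "fps_rpow radicand (1/2) :: 'a poly fps"
  have "2 * (?s * fps_deriv ?s) = fps_deriv (?s ^ 2)"
    by (simp add: power2_eq_square)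
  also have "\<dots> = 2 * (2 * fps_X ^ 3 - 2 * fps_const indet_c * fps_X)"
    unfolding radicand_sqrt
    by (simp add: radicand_def fps_deriv_power algebra_simps power_numeral_reduce)
  finally show ?thesis by (simp only: mult_left_cancel[OF zero_neq_numeral[symmetric]])
qed

lemma genfun_op_solution:
  fixes T :: "'a::field_char_0 poly fls"
  assumes "(T * fps_to_fls (fps_rpow radicand (-3/2))) $$ (-1) = 0"
  shows "genfun_op (fls_X * fps_to_fls (fps_rpow radicand (1/2)) *
      fls_poly_integral (T * fps_to_fls (fps_rpow radicand (-3/2)))) = fls_X ^ 2 * T"
proof -
  define s where "s = fps_to_fls (fps_rpow radicand (1/2) :: 'a poly fps)"
  define r where "r = fps_to_fls (fps_rpow radicand (-3/2) :: 'a poly fps)"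
  define I where "I = fls_poly_integral (T * r)"
  have dI: "fls_deriv I = T * r"
    unfolding I_def using assms by (simp add: fls_deriv_poly_integral r_def)
  have R: "fps_to_fls radicand = s ^ 2"
    by (simp add: s_def radicand_sqrt flip: fps_to_fls_power)
  have ds: "s * fls_deriv s = 2 * fls_X ^ 3 - 2 * fls_const indet_c * fls_X"
    using arg_cong[OF sqrt_radicand_deriv[where 'a = 'a], of fps_to_fls]
    by (simp add: s_def fls_times_fps_to_fls fps_to_fls_power fls_deriv_fps_to_fls)
  have rs: "r * s ^ 3 = 1"
    using arg_cong[OF radicand_neg_three_halves[where 'a = 'a], of fps_to_fls]
    by (simp add: s_def r_def fls_times_fps_to_fls fps_to_fls_power)
  have s2: "s ^ 2 = 1 - 2 * fls_const indet_c * fls_X ^ 2 + fls_X ^ 4"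
    using R radicand_to_fls by metis
  \<comment> \<open>Product rule: the first summand is the homogeneous part, the second comes from
    \<open>I' = T r\<close> and collapses to \<open>z^2 T\<close> by \<open>rs\<close>.\<close>
  have "fls_X * s ^ 2 * fls_deriv (fls_X * s * I) =
      (s ^ 2 + fls_X * (s * fls_deriv s)) * (fls_X * s * I) + fls_X ^ 2 * T * (r * s ^ 3)"
    by (simp add: dI algebra_simps power_numeral_reduce)
  also have "s ^ 2 + fls_X * (s * fls_deriv s) =
      1 - 4 * fls_const indet_c * fls_X ^ 2 + 3 * fls_X ^ 4"
    unfolding ds s2 by (simp add: algebra_simps power_numeral_reduce)
  finally show ?thesis
    unfolding genfun_op_def R rs s_def[symmetric] r_def[symmetric] I_def[symmetric] by simp
qed

text \<open>The integral for \<open>P_-4\<close> starts at \<open>z^-1\<close>, so one factor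
  \<open>fls_X\<close> already makes it a power series.\<close>

lemma fls_X_times_fps_to_fls_times_nth_1:
  fixes f :: "'a::comm_ring_1 fls"
  assumes "\<And>n. n < -1 \<Longrightarrow> f $$ n = 0"
  shows "(fls_X * fps_to_fls s * f) $$ 1 = s $ 0 * f $$ 0 + s $ 1 * f $$ (-1)"
proof -
  have "fls_X * f = fps_to_fls (Abs_fps (\<lambda>n. f $$ (int n - 1)))"
    using assms by (intro fls_eqI) (simp add: fls_X_times_conv_shift)
  then have "fls_X * fps_to_fls s * f = fps_to_fls (s * Abs_fps (\<lambda>n. f $$ (int n - 1)))"
    by (metis fls_X_times_comm fls_times_fps_to_fls mult.assoc)
  then show ?thesis
    by (simp add: fps_mult_nth)
qed

text \<open>The recursion at \<open>k = n - 4\<close> annihilates the coefficients with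
  \<open>n \<ge> 4\<close>. Below that, \<open>?F\<close> vanishes at negative indices and only
  initial values survive.\<close>

lemma genfun_op_recursion:
  fixes P :: "int \<Rightarrow> 'a::field_char_0 poly"
  assumes rec: "\<And>k. k \<ge> 0 \<Longrightarrow>
      of_int (6 + 2 * k) * P k =
        of_int (4 * k) * indet_c * P (k - 2) - of_int (2 * (k - 3)) * P (k - 4)"
    and odd: "P (-3) = 0" "P (-1) = 0"
  shows "genfun_op (fps_to_fls (Abs_fps (\<lambda>k. P (int k - 4)))) =
    fls_const (P (-2) + 4 * indet_c * P (-4)) * fls_X ^ 2 - fls_const (P (-4))"
    (is "genfun_op ?F = ?S")
proof (rule fls_eqI)
  fix n :: int
  have F: "?F $$ m = (if m < 0 then 0 else P (m - 4))" for m
    by simp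
  have S: "?S $$ m = (if m = 2 then P (-2) + 4 * indet_c * P (-4) else 0)
      - (if m = 0 then P (-4) else 0)" for m
    by (simp add: fls_X_power_conv_shift_1)
  consider "n < 0" | "n = 0" | "n = 1" | "n = 2" | "n = 3" | "n \<ge> 4" by linarith
  then show "genfun_op ?F $$ n = ?S $$ n"
  proof cases
    case 6
    have "2 * (of_int (n - 1) * P (n - 4) - 2 * of_int (n - 4) * indet_c * P (n - 6)
        + of_int (n - 7) * P (n - 8)) = 0"
      using rec[of "n - 4"] 6 by (simp add: algebra_simps)
    then have "of_int (n - 1) * P (n - 4) - 2 * of_int (n - 4) * indet_c * P (n - 6)
        + of_int (n - 7) * P (n - 8) = 0"
      using mult_eq_0_iff zero_neq_numeral by metis
    then show ?thesis
      using 6 by (simp only: genfun_op_nth F S) simp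
  qed (simp_all only: genfun_op_nth F S, simp_all add: odd)
qed

theorem mainTheorem2:
  fixes P\<^sub>4 P\<^sub>2 :: "int \<Rightarrow> 'a::field_char_0 poly"
  assumes rec4: "\<And>k. k \<ge> 0 \<Longrightarrow>
      of_int (6 + 2 * k) * P\<^sub>4 k =
        of_int (4 * k) * indet_c * P\<^sub>4 (k - 2) - of_int (2 * (k - 3)) * P\<^sub>4 (k - 4)"
    and init4: "P\<^sub>4 (-4) = 1" "P\<^sub>4 (-3) = 0" "P\<^sub>4 (-2) = 0" "P\<^sub>4 (-1) = 0"
    and rec2: "\<And>k. k \<ge> 0 \<Longrightarrow>
      of_int (6 + 2 * k) * P\<^sub>2 k =
        of_int (4 * k) * indet_c * P\<^sub>2 (k - 2) - of_int (2 * (k - 3)) * P\<^sub>2 (k - 4)"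
    and init2: "P\<^sub>2 (-2) = 1" "P\<^sub>2 (-4) = 0" "P\<^sub>2 (-3) = 0" "P\<^sub>2 (-1) = 0"
  shows "(fps_to_fls (Abs_fps (\<lambda>k. P\<^sub>4 (int k - 4))) =
           fls_X * fps_to_fls (fps_rpow radicand (1/2)) *
           fls_poly_integral
             ((4 * fls_const indet_c * fls_X ^ 2 - 1) * fls_X_inv ^ 2 *
              fps_to_fls (fps_rpow radicand (-3/2)))) \<and>
         (fps_to_fls (Abs_fps (\<lambda>k. P\<^sub>2 (int k - 4))) =
           fls_X * fps_to_fls (fps_rpow radicand (1/2)) *
           fls_poly_integral (fps_to_fls (fps_rpow radicand (-3/2))))"
proof
  let ?s = "fps_rpow radicand (1/2) :: 'a poly fps"
  let ?r = "fps_rpow radicand (-3/2) :: 'a poly fps"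
  let ?T = "(4 * fls_const indet_c * fls_X ^ 2 - 1) * fls_X_inv ^ 2 :: 'a poly fls"
  have X_inv: "fls_X ^ 2 * fls_X_inv ^ 2 = (1 :: 'a poly fls)"
    by (simp add: fls_X_power_times_conv_shift fls_X_inv_power_conv_shift_1)
  \<comment> \<open>Simplification of the source term produces \<open>pCons 0 4\<close> from
    \<open>4 * indet_c\<close>.\<close>
  have c4: "fls_const (pCons 0 4) = 4 * fls_const (indet_c :: 'a poly)"
    by (rule fls_eqI) simp
  have T: "?T = 4 * fls_const indet_c - fls_X_inv ^ 2"
    using arg_cong[OF X_inv, of "(*) (4 * fls_const indet_c)"]
    by (simp add: left_diff_distrib mult.assoc)
  have Tr: "(?T * fps_to_fls ?r) $$ n =
      4 * indet_c * fps_to_fls ?r $$ n - fps_to_fls ?r $$ (n + 2)" for n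
    unfolding T by (simp add: left_diff_distrib mult.assoc fls_X_inv_power_times_conv_shift)
  show "fps_to_fls (Abs_fps (\<lambda>k. P\<^sub>4 (int k - 4))) =
      fls_X * fps_to_fls ?s * fls_poly_integral (?T * fps_to_fls ?r)"
  proof (rule genfun_op_inj)
    have "genfun_op (fls_X * fps_to_fls ?s * fls_poly_integral (?T * fps_to_fls ?r))
        = fls_X ^ 2 * ?T"
      \<comment> \<open>By \<open>Tr\<close>, the \<open>z^-1\<close> coefficient of the integrand
        is minus the \<open>z^1\<close> coefficient of \<open>?r\<close>, which is zero.\<close>
      by (rule genfun_op_solution) (simp only: Tr, simp)
    also have "\<dots> = (4 * fls_const indet_c * fls_X ^ 2 - 1) * (fls_X ^ 2 * fls_X_inv ^ 2)"
      by (simp only: ac_simps)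
    finally show "genfun_op (fps_to_fls (Abs_fps (\<lambda>k. P\<^sub>4 (int k - 4)))) =
        genfun_op (fls_X * fps_to_fls ?s * fls_poly_integral (?T * fps_to_fls ?r))"
      using init4 by (simp add: genfun_op_recursion[OF rec4] X_inv c4)
    show "fps_to_fls (Abs_fps (\<lambda>k. P\<^sub>4 (int k - 4))) $$ 1 =
        (fls_X * fps_to_fls ?s * fls_poly_integral (?T * fps_to_fls ?r)) $$ 1"
      \<comment> \<open>Both sides vanish: the integral has no constant term, and \<open>?s\<close>
        has no \<open>z^1\<close> term to meet its \<open>z^-1\<close> term.\<close>
      using init4
      by (subst fls_X_times_fps_to_fls_times_nth_1)
         (simp_all only: fls_poly_integral_nth Tr, simp_all)
  qed
  show "fps_to_fls (Abs_fps (\<lambda>k. P\<^sub>2 (int k - 4))) =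
      fls_X * fps_to_fls ?s * fls_poly_integral (fps_to_fls ?r)"
  proof (rule genfun_op_inj)
    have "genfun_op (fls_X * fps_to_fls ?s * fls_poly_integral (fps_to_fls ?r)) = fls_X ^ 2"
      using genfun_op_solution[of 1] by simp
    then show "genfun_op (fps_to_fls (Abs_fps (\<lambda>k. P\<^sub>2 (int k - 4)))) =
        genfun_op (fls_X * fps_to_fls ?s * fls_poly_integral (fps_to_fls ?r))"
      using init2 by (simp add: genfun_op_recursion[OF rec2])
    show "fps_to_fls (Abs_fps (\<lambda>k. P\<^sub>2 (int k - 4))) $$ 1 =
        (fls_X * fps_to_fls ?s * fls_poly_integral (fps_to_fls ?r)) $$ 1"
      using init2 by (subst fls_X_times_fps_to_fls_times_nth_1) simp_all
  qed
qed

end
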